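(* Let $k$ be a field of characteristic $0$, let $\epsilon\in k$, $\epsilon\ne0$, $\epsilon^{-1}\notin\mathbf{Z}$, let $K=k[x,x^{-1}]$ with the derivation $\partial=d/dx$ (written also $'$), and let $\mathcal{O}=x\frac{d}{dx}-1:K\to K$. For $u,v\in K$ set $$u*v=(1-\epsilon\mathcal{O})^{-1}\left(x^{-1}\,u\cdot(1-\epsilon\mathcal{O})\mathcal{O}(v)\right),\qquad \hat\Omega(u,v)=x^{-3}\left(\mathcal{O}^2(1+\epsilon\mathcal{O})(u)\right)\cdot v .$$ Then: (1) $*$ is a quasiassociative multiplication on $K$, with $u*v-v*u=uv'-u'v$ for all $u,v\in K$, and $x^{1-p}*x^{1-q}=-\frac{q(1+\epsilon q)}{1+\epsilon(p+q)}x^{1-p-q}$ for all $p,q\in\mathbf{Z}$. (2) $\hat\Omega$ is a generalized 2-cocycle on the quasiassociative algebra $(K,* )$. (3) The form $$\hat\Omega^{\mathrm{new}}(u,v)=-\tfrac12\epsilon^{-1}x^{-3}\left(\mathcal{O}^2(1+\epsilon\mathcal{O})(u)\right)\cdot v-\tfrac12x^{-2}\,(u*v)$$ is a generalized 2-cocycle on $(K,* )$, and for all $p,q\in\mathbf{Z}$ $$\mathrm{Res}\;\hat\Omega^{\mathrm{new}}\left(x^{1-p},x^{1-q}\right)=\tfrac12\left[p^3-p+\left(\epsilon-\epsilon^{-1}\right)p^2\right]\delta^0_{p+q}.$$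
   Context: An algebra with bilinear multiplication $*$ is quasiassociative if $a*(b*c)-(a*b)*c=b*(a*c)-(b*a)*c$ for all $a,b,c$. The operator $1-\epsilon\mathcal{O}$ is invertible on $k[x,x^{-1}]$ since $\mathcal{O}(x^{1-q})=-q\,x^{1-q}$ and $1+\epsilon q\neq0$ for all $q\in\mathbf{Z}$. For $f,g\in K$, $f\sim g$ means $f-g\in\mathrm{Im}\,\partial$. A $k$-bilinear form $\hat\Omega:K\times K\to K$ is a generalized 2-cocycle on $(K,* )$ if $\hat\Omega(v,u*w)-\hat\Omega(u,v*w)+\hat\Omega([u,v],w)\sim0$ for all $u,v,w\in K$, where $[u,v]=u*v-v*u$. $\mathrm{Res}:k[x,x^{-1}]\to k$ takes the coefficient of $x^{-1}$. $\delta^0_n$ is $1$ if $n=0$ and $0$ otherwise. *)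

theory Defs
  imports Complex_Main "HOL-Library.Poly_Mapping"
begin

text \<open>
  The Laurent polynomial ring \<open>k[x, x\<inverse>]\<close> is the group ring of the integers over \<open>k\<close>: finitely
  supported functions from exponents to coefficients. The library's ring structure on
  \<open>int \<Rightarrow>\<^sub>0 'a\<close> is multiplication by convolution.
\<close>

type_synonym 'a laurent = "int \<Rightarrow>\<^sub>0 'a"

definition X :: "int \<Rightarrow> 'a::comm_ring_1 laurent"
  where "X n = Poly_Mapping.single n 1"

definition scale :: "'a::comm_ring_1 \<Rightarrow> 'a laurent \<Rightarrow> 'a laurent"
  where "scale c f = Poly_Mapping.single 0 c * f"

definition deriv :: "'a::comm_ring_1 laurent \<Rightarrow> 'a laurent"
  where "deriv f =
    (\<Sum>n\<in>Poly_Mapping.keys f. Poly_Mapping.single (n - 1) (of_int n * Poly_Mapping.lookup f n))"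

definition Res :: "'a::comm_ring_1 laurent \<Rightarrow> 'a"
  where "Res f = Poly_Mapping.lookup f (- 1)"

definition sim :: "'a::comm_ring_1 laurent \<Rightarrow> 'a laurent \<Rightarrow> bool"  (infix \<open>\<sim>\<close> 50)
  where "f \<sim> g \<longleftrightarrow> f - g \<in> range deriv"

definition bilinear_map :: "('a::field laurent \<Rightarrow> 'a laurent \<Rightarrow> 'a laurent) \<Rightarrow> bool"
  where "bilinear_map m \<longleftrightarrow>
    (\<forall>u. Vector_Spaces.linear scale scale (\<lambda>v. m u v)) \<and>
    (\<forall>v. Vector_Spaces.linear scale scale (\<lambda>u. m u v))"

definition quasiassociative :: "('a::field laurent \<Rightarrow> 'a laurent \<Rightarrow> 'a laurent) \<Rightarrow> bool"
  where "quasiassociative m \<longleftrightarrow> bilinear_map m \<and>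
    (\<forall>a b c. m a (m b c) - m (m a b) c = m b (m a c) - m (m b a) c)"

definition generalized_2_cocycle ::
    "('a::field laurent \<Rightarrow> 'a laurent \<Rightarrow> 'a laurent) \<Rightarrow>
     ('a laurent \<Rightarrow> 'a laurent \<Rightarrow> 'a laurent) \<Rightarrow> bool"
  where "generalized_2_cocycle m \<Omega> \<longleftrightarrow> bilinear_map \<Omega> \<and>
    (\<forall>u v w. \<Omega> v (m u w) - \<Omega> u (m v w) + \<Omega> (m u v - m v u) w \<sim> 0)"

definition euler :: "'a::comm_ring_1 laurent \<Rightarrow> 'a laurent"
  where "euler f = X 1 * deriv f - f"

definition one_plus :: "'a::comm_ring_1 \<Rightarrow> 'a laurent \<Rightarrow> 'a laurent"
  where "one_plus \<epsilon> f = f + scale \<epsilon> (euler f)"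

definition one_minus :: "'a::comm_ring_1 \<Rightarrow> 'a laurent \<Rightarrow> 'a laurent"
  where "one_minus \<epsilon> f = f - scale \<epsilon> (euler f)"

text \<open>\<open>inv\<close> is a genuine two-sided inverse under the standing hypotheses: see \<open>bij_one_minus\<close> below.\<close>

definition star :: "'a::field \<Rightarrow> 'a laurent \<Rightarrow> 'a laurent \<Rightarrow> 'a laurent"
  where "star \<epsilon> u v = inv (one_minus \<epsilon>) (X (- 1) * u * one_minus \<epsilon> (euler v))"

definition Omega :: "'a::field \<Rightarrow> 'a laurent \<Rightarrow> 'a laurent \<Rightarrow> 'a laurent"
  where "Omega \<epsilon> u v = X (- 3) * (euler ^^ 2) (one_plus \<epsilon> u) * v"

definition Omega_new :: "'a::field \<Rightarrow> 'a laurent \<Rightarrow> 'a laurent \<Rightarrow> 'a laurent"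
  where "Omega_new \<epsilon> u v =
    scale (- (1 / 2) * inverse \<epsilon>) (X (- 3) * (euler ^^ 2) (one_plus \<epsilon> u) * v)
      - scale (1 / 2) (X (- 2) * star \<epsilon> u v)"

lemma lookup_scale: "Poly_Mapping.lookup (scale c f) n = c * Poly_Mapping.lookup f n"
proof -
  have "Poly_Mapping.single 0 c * f = Poly_Mapping.map ((*) c) f"
    by (rule mult_map_scale_conv_mult [symmetric])
  then show ?thesis
    by (simp add: scale_def Poly_Mapping.map.rep_eq when_def)
qed

lemma lookup_X_mult: "Poly_Mapping.lookup (X k * f) n = Poly_Mapping.lookup f (n - k)"
proof (induction f rule: update_induct)
  case const
  then show ?case by simp
next
  case (update f a b)
  have "Poly_Mapping.update a b f = f + Poly_Mapping.single a b"
    using update.hyps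
    by (auto intro!: poly_mapping_eqI simp: lookup_update lookup_add lookup_single when_def in_keys_iff)
  with update.IH show ?case
    by (auto simp: X_def distrib_left lookup_add mult_single lookup_single when_def)
qed

lemma lookup_deriv: "Poly_Mapping.lookup (deriv f) n = of_int (n + 1) * Poly_Mapping.lookup f (n + 1)"
proof -
  have "Poly_Mapping.lookup (deriv f) n =
      (\<Sum>k\<in>Poly_Mapping.keys f. if k = n + 1 then of_int k * Poly_Mapping.lookup f k else 0)"
    unfolding deriv_def lookup_sum
    by (intro sum.cong) (auto simp: lookup_single when_def)
  also have "\<dots> = of_int (n + 1) * Poly_Mapping.lookup f (n + 1)"
    by (simp add: in_keys_iff)
  finally show ?thesis .
qed

lemma lookup_euler: "Poly_Mapping.lookup (euler f) n = of_int (n - 1) * Poly_Mapping.lookup f n"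
  by (simp add: euler_def lookup_minus lookup_X_mult lookup_deriv algebra_simps)

lemma lookup_one_minus:
  "Poly_Mapping.lookup (one_minus \<epsilon> f) n = (1 - \<epsilon> * of_int (n - 1)) * Poly_Mapping.lookup f n"
  by (simp add: one_minus_def lookup_minus lookup_scale lookup_euler algebra_simps)

lemma vector_space_scale: "vector_space (scale :: 'a::field \<Rightarrow> 'a laurent \<Rightarrow> 'a laurent)"
  by unfold_locales (auto intro!: poly_mapping_eqI simp: lookup_scale lookup_add algebra_simps)

lemma bij_one_minus:
  fixes \<epsilon> :: "'a::field_char_0"
  assumes "\<epsilon> \<noteq> 0" and "inverse \<epsilon> \<notin> \<int>"
  shows "bij (one_minus \<epsilon>)"
proof -
  have nz: "1 - \<epsilon> * of_int n \<noteq> 0" for n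
  proof
    assume "1 - \<epsilon> * of_int n = 0"
    then have "inverse \<epsilon> = of_int n" using assms(1) by (simp add: field_simps)
    then show False using assms(2) by simp
  qed
  define h where
    "h = (\<lambda>f :: 'a laurent. Poly_Mapping.mapp (\<lambda>n c. c / (1 - \<epsilon> * of_int (n - 1))) f)"
  have h: "Poly_Mapping.lookup (h f) n = Poly_Mapping.lookup f n / (1 - \<epsilon> * of_int (n - 1))" for f n
    by (auto simp: h_def lookup_mapp when_def in_keys_iff)
  show ?thesis
  proof (rule bij_betw_byWitness [where f' = h])
    show "\<forall>f\<in>UNIV. h (one_minus \<epsilon> f) = f"
      using nz by (auto intro!: poly_mapping_eqI simp: h lookup_one_minus simp del: of_int_diff)
    show "\<forall>f\<in>UNIV. one_minus \<epsilon> (h f) = f"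
      using nz by (auto intro!: poly_mapping_eqI simp: h lookup_one_minus simp del: of_int_diff)
  qed auto
qed

end

theory Submission
  imports Defs
begin

text \<open>
  Everything is multilinear, so it suffices to test on the monomials \<open>e\<^sub>p = x\<^sup>1\<^sup>-\<^sup>p\<close>, on which \<open>euler\<close>
  acts as multiplication by \<open>-p\<close>. The associator of \<open>e\<^sub>p, e\<^sub>q, e\<^sub>r\<close> has coefficient
  \<open>r (1 + \<epsilon> r) / (1 + \<epsilon> (p + q + r)) * (r + \<epsilon> p q / (1 + \<epsilon> (p + q)))\<close>, visibly symmetric in
  \<open>p, q\<close>. Since \<open>f \<sim> 0\<close> means that the residue of \<open>f\<close> vanishes, the cocycle condition for \<open>Omega\<close>
  only needs checking for \<open>p + q + r = 0\<close>, where the denominator of \<open>star\<close> cancels against the factor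
  \<open>1 + \<epsilon> euler\<close>. The second term of \<open>Omega_new\<close> satisfies the cocycle condition exactly, by
  quasiassociativity.
\<close>

section \<open>Reduction of additive identities to monomials\<close>

lemma additive_laurent_eq_0:
  fixes F :: "'a::comm_ring_1 laurent \<Rightarrow> 'b::ab_group_add"
  assumes "\<And>f g. F (f + g) = F f + F g"
    and "\<And>p c. F (Poly_Mapping.single (1 - p) c) = 0"
  shows "F f = 0"
proof (induction f rule: update_induct)
  case const
  show ?case using assms(1)[of 0 0] by simp
next
  case (update f a b)
  have "Poly_Mapping.update a b f = f + Poly_Mapping.single a b"
    using update.hyps
    by (auto intro!: poly_mapping_eqI simp: lookup_update lookup_add lookup_single when_def in_keys_iff)
  then show ?case
    using update.IH assms(1) assms(2)[of "1 - a" b] by simp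
qed

text \<open>The one-variable reduction is applied to the three arguments in turn, from the last to
  the first. Only additivity is asked for, so the monomials carry arbitrary coefficients. The
  general target group covers both Laurent-valued identities and identities between
  residues.\<close>

lemma trilinear_laurent_eq_0:
  fixes F :: "'a::comm_ring_1 laurent \<Rightarrow> 'a laurent \<Rightarrow> 'a laurent \<Rightarrow> 'b::ab_group_add"
  assumes "\<And>f g v w. F (f + g) v w = F f v w + F g v w"
    and "\<And>f g u w. F u (f + g) w = F u f w + F u g w"
    and "\<And>f g u v. F u v (f + g) = F u v f + F u v g"
    and "\<And>p q r a b c. F (Poly_Mapping.single (1 - p) a) (Poly_Mapping.single (1 - q) b)
          (Poly_Mapping.single (1 - r) c) = 0"
  shows "F u v w = 0"
proof -
  have 1: "F (Poly_Mapping.single (1 - p) a) (Poly_Mapping.single (1 - q) b) w = 0" for p q a b w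
    by (rule additive_laurent_eq_0) (rule assms)+
  have 2: "F (Poly_Mapping.single (1 - p) a) v w = 0" for p a v w
    by (rule additive_laurent_eq_0[where F = "\<lambda>v. F _ v w"]) (rule assms 1)+
  show ?thesis
    by (rule additive_laurent_eq_0[where F = "\<lambda>u. F u v w"]) (rule assms 2)+
qed

section \<open>The residue as the only obstruction to integration\<close>

lemma sim_0_iff:
  fixes f :: "'a::field_char_0 laurent"
  shows "f \<sim> 0 \<longleftrightarrow> Res f = 0"
proof
  assume "f \<sim> 0"
  \<comment> \<open>In a derivative, the coefficient of \<open>x^(-1)\<close> carries the factor
    \<open>(-1) + 1 = 0\<close>.\<close>
  then show "Res f = 0"
    by (auto simp: sim_def Res_def lookup_deriv)
next
  assume res: "Res f = 0"
  \<comment> \<open>The termwise antiderivative: divide by \<open>n + 1\<close>, then raise the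
    exponent by one. At \<open>n = -1\<close> the quotient is a division by zero, harmless because
    \<open>deriv\<close> multiplies that coefficient by 0 and \<open>Res f = 0\<close>.\<close>
  define g where "g = X 1 * Poly_Mapping.mapp (\<lambda>n c. c / of_int (n + 1)) f"
  \<comment> \<open>Characteristic 0 keeps \<open>n + 1\<close> nonzero in the field.\<close>
  have nz: "(1 + of_int n :: 'a) \<noteq> 0" if "n \<noteq> -1" for n
  proof -
    have "of_int (1 + n) \<noteq> (0 :: 'a)"
      using that by (simp only: of_int_eq_0_iff)
    then show ?thesis by simp
  qed
  have "deriv g = f"
  proof (rule poly_mapping_eqI)
    fix n
    show "Poly_Mapping.lookup (deriv g) n = Poly_Mapping.lookup f n"
      using res nz[of n]
      by (cases "n = -1")
        (auto simp: g_def Res_def lookup_deriv lookup_X_mult lookup_mapp when_def in_keys_iff add_ac)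
  qed
  then show "f \<sim> 0" unfolding sim_def by auto
qed

section \<open>Linearity of the operators and their action on monomials\<close>

lemma bilinear_mapI:
  assumes "\<And>u v w. m u (v + w) = m u v + m u w" "\<And>u v w. m (u + v) w = m u w + m v w"
    and "\<And>c u v. m u (scale c v) = scale c (m u v)" "\<And>c u v. m (scale c u) v = scale c (m u v)"
  shows "bilinear_map m"
  unfolding bilinear_map_def Vector_Spaces.linear_iff using assms vector_space_scale by blast

lemma scale_single: "scale c (Poly_Mapping.single n d) = Poly_Mapping.single n (c * d)"
  by (simp add: scale_def mult_single)

lemma scale_add: "scale c (f + g) = scale c f + scale c g"
  by (simp add: scale_def distrib_left)

lemma scale_diff: "scale c (f - g) = scale c f - scale c g"
  by (simp add: scale_def right_diff_distrib)

lemma scale_scale: "scale c (scale d f) = scale (c * d) f"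
  by (simp add: poly_mapping_eqI lookup_scale mult.assoc)

lemma scale_mult_left: "scale c f * g = scale c (f * g)"
  by (simp add: scale_def mult.assoc)

lemma scale_mult_right: "f * scale c g = scale c (f * g)"
  by (simp add: scale_def mult.left_commute)

lemma euler_add: "euler (f + g) = euler f + euler g"
  by (rule poly_mapping_eqI) (simp add: lookup_euler lookup_add distrib_left)

lemma euler_scale: "euler (scale c f) = scale c (euler f)"
  by (rule poly_mapping_eqI) (simp add: lookup_euler lookup_scale mult.left_commute)

lemma deriv_add: "deriv (f + g) = deriv f + deriv g"
  by (rule poly_mapping_eqI) (simp add: lookup_deriv lookup_add distrib_left)

lemma one_minus_add: "one_minus \<epsilon> (f + g) = one_minus \<epsilon> f + one_minus \<epsilon> g"
  by (rule poly_mapping_eqI) (simp add: lookup_one_minus lookup_add distrib_left)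

lemma one_minus_scale: "one_minus \<epsilon> (scale c f) = scale c (one_minus \<epsilon> f)"
  by (rule poly_mapping_eqI) (simp add: lookup_one_minus lookup_scale mult.left_commute)

lemma one_plus_add: "one_plus \<epsilon> (f + g) = one_plus \<epsilon> f + one_plus \<epsilon> g"
  by (simp add: one_plus_def euler_add scale_add)

lemma one_plus_scale: "one_plus \<epsilon> (scale c f) = scale c (one_plus \<epsilon> f)"
  by (simp add: one_plus_def euler_scale scale_add scale_scale mult.commute)

lemma Res_add: "Res (f + g) = Res f + Res g"
  by (simp add: Res_def lookup_add)

lemma Res_diff: "Res (f - g) = Res f - Res g"
  by (simp add: Res_def lookup_minus)

lemma Res_scale: "Res (scale c f) = c * Res f"
  by (simp add: Res_def lookup_scale)

text \<open>The exponent has the shape produced by \<open>Omega\<close>, since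
  \<open>x^(-3) * x^(1-p) * x^(1-q) = x^(-1-(p+q))\<close>.\<close>

lemma Res_single: "Res (Poly_Mapping.single (- 1 - n) c) = (if n = 0 then c else 0)"
  by (auto simp: Res_def lookup_single when_def)

lemma deriv_single: "deriv (Poly_Mapping.single n c) = Poly_Mapping.single (n - 1) (of_int n * c)"
  by (rule poly_mapping_eqI) (auto simp: lookup_deriv lookup_single when_def)

lemma euler_single:
  "euler (Poly_Mapping.single (1 - p) c) = Poly_Mapping.single (1 - p) (- (of_int p * c))"
  by (rule poly_mapping_eqI) (auto simp: lookup_euler lookup_single when_def)

lemma one_minus_single:
  "one_minus \<epsilon> (Poly_Mapping.single (1 - p) c) = Poly_Mapping.single (1 - p) ((1 + \<epsilon> * of_int p) * c)"
  by (rule poly_mapping_eqI) (auto simp: lookup_one_minus lookup_single when_def)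

lemma one_plus_single:
  "one_plus \<epsilon> (Poly_Mapping.single (1 - p) c) = Poly_Mapping.single (1 - p) ((1 - \<epsilon> * of_int p) * c)"
  by (simp add: one_plus_def euler_single scale_single single_add[symmetric] algebra_simps)

lemma Omega_single:
  "Omega \<epsilon> (Poly_Mapping.single (1 - p) a) (Poly_Mapping.single (1 - q) b) =
    Poly_Mapping.single (- 1 - (p + q)) (of_int p ^ 2 * (1 - \<epsilon> * of_int p) * a * b)"
  by (simp add: Omega_def X_def numeral_2_eq_2 one_plus_single euler_single mult_single algebra_simps)

lemma Omega_add_left: "Omega \<epsilon> (u + v) w = Omega \<epsilon> u w + Omega \<epsilon> v w"
  by (simp add: Omega_def numeral_2_eq_2 one_plus_add euler_add distrib_left distrib_right)

lemma Omega_add_right: "Omega \<epsilon> u (v + w) = Omega \<epsilon> u v + Omega \<epsilon> u w"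
  by (simp add: Omega_def distrib_left)

lemma Omega_diff_left: "Omega \<epsilon> (u - v) w = Omega \<epsilon> u w - Omega \<epsilon> v w"
  by (metis add_diff_cancel_right' diff_add_cancel Omega_add_left)

lemma Omega_scale_left: "Omega \<epsilon> (scale c u) v = scale c (Omega \<epsilon> u v)"
  by (simp add: Omega_def numeral_2_eq_2 one_plus_scale euler_scale scale_mult_left scale_mult_right)

lemma Omega_scale_right: "Omega \<epsilon> u (scale c v) = scale c (Omega \<epsilon> u v)"
  by (simp add: Omega_def scale_mult_right)

lemma bilinear_Omega: "bilinear_map (Omega \<epsilon>)"
  by (intro bilinear_mapI Omega_add_left Omega_add_right Omega_scale_left Omega_scale_right)

section \<open>The product \<open>star\<close>: monomial formula, commutator,
  quasiassociativity\<close>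

context
  fixes \<epsilon> :: "'a::field_char_0"
  assumes nonzero: "\<epsilon> \<noteq> 0" and nonint: "inverse \<epsilon> \<notin> \<int>"
begin

text \<open>A zero would make \<open>inverse \<epsilon>\<close> the integer \<open>- n\<close>.
  These numbers are the eigenvalues of \<open>one_minus \<epsilon>\<close> on
  \<open>x^(1-n)\<close>, hence the denominators of \<open>star\<close>.\<close>

lemma one_plus_int_nonzero: "1 + \<epsilon> * of_int n \<noteq> 0"
proof
  assume "1 + \<epsilon> * of_int n = 0"
  then have "inverse \<epsilon> = of_int (- n)"
    using nonzero by (simp add: field_simps add_eq_0_iff)
  then show False using nonint by (metis Ints_of_int)
qed

text \<open>Bijectivity makes \<open>inv\<close> a true inverse, so each of its values can be
  verified by applying \<open>one_minus \<epsilon>\<close> to the claimed result.\<close>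

lemma inv_one_minus_eqI: "one_minus \<epsilon> g = f \<Longrightarrow> inv (one_minus \<epsilon>) f = g"
  using bij_one_minus[OF nonzero nonint] by (metis bij_inv_eq_iff)

lemma one_minus_inv: "one_minus \<epsilon> (inv (one_minus \<epsilon>) f) = f"
  using bij_one_minus[OF nonzero nonint] by (metis bij_inv_eq_iff)

lemma inv_one_minus_add:
  "inv (one_minus \<epsilon>) (f + g) = inv (one_minus \<epsilon>) f + inv (one_minus \<epsilon>) g"
  by (rule inv_one_minus_eqI) (simp add: one_minus_add one_minus_inv)

lemma inv_one_minus_scale: "inv (one_minus \<epsilon>) (scale c f) = scale c (inv (one_minus \<epsilon>) f)"
  by (rule inv_one_minus_eqI) (simp add: one_minus_scale one_minus_inv)

lemma inv_one_minus_single: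
  "inv (one_minus \<epsilon>) (Poly_Mapping.single (1 - p) c) =
    Poly_Mapping.single (1 - p) (c / (1 + \<epsilon> * of_int p))"
  by (rule inv_one_minus_eqI) (simp add: one_minus_single one_plus_int_nonzero)

lemma star_single:
  "star \<epsilon> (Poly_Mapping.single (1 - p) a) (Poly_Mapping.single (1 - q) b) =
    Poly_Mapping.single (1 - (p + q))
      (- (of_int q * (1 + \<epsilon> * of_int q) * a * b / (1 + \<epsilon> * of_int (p + q))))"
proof -
  have "X (- 1) * Poly_Mapping.single (1 - p) a *
        one_minus \<epsilon> (euler (Poly_Mapping.single (1 - q) b)) =
      Poly_Mapping.single (1 - (p + q)) (- (of_int q * (1 + \<epsilon> * of_int q) * a * b))"
    by (simp add: X_def euler_single one_minus_single mult_single algebra_simps)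
  then show ?thesis
    unfolding star_def by (simp only: inv_one_minus_single minus_divide_left)
qed

lemma star_add_left: "star \<epsilon> (u + v) w = star \<epsilon> u w + star \<epsilon> v w"
  by (simp add: star_def distrib_left distrib_right inv_one_minus_add)

lemma star_add_right: "star \<epsilon> u (v + w) = star \<epsilon> u v + star \<epsilon> u w"
  by (simp add: star_def distrib_left euler_add one_minus_add inv_one_minus_add)

lemma star_scale_left: "star \<epsilon> (scale c u) v = scale c (star \<epsilon> u v)"
  by (simp add: star_def scale_mult_left scale_mult_right inv_one_minus_scale)

lemma star_scale_right: "star \<epsilon> u (scale c v) = scale c (star \<epsilon> u v)"
  by (simp add: star_def euler_scale one_minus_scale scale_mult_right inv_one_minus_scale)

lemma star_diff_left: "star \<epsilon> (u - v) w = star \<epsilon> u w - star \<epsilon> v w"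
  by (metis add_diff_cancel_right' diff_add_cancel star_add_left)

lemma bilinear_star: "bilinear_map (star \<epsilon>)"
  by (intro bilinear_mapI star_add_left star_add_right star_scale_left star_scale_right)

text \<open>On monomials the denominator cancels because \<open>p (1 + \<epsilon> p) - q (1 +
  \<epsilon> q) = (p - q) (1 + \<epsilon> (p + q))\<close>.\<close>

lemma star_commutator: "star \<epsilon> u v - star \<epsilon> v u = u * deriv v - deriv u * v"
proof -
  define F where "F u v = star \<epsilon> u v - star \<epsilon> v u - (u * deriv v - deriv u * v)" for u v
  have 1: "F (Poly_Mapping.single (1 - p) a) (Poly_Mapping.single (1 - q) b) = 0" for p q a b
  proof -
    \<comment> \<open>The denominator stays opaque while fractions are cleared and is unfolded only
      for the remaining polynomial identity.\<close>
    define d where "d = 1 + \<epsilon> * (of_int p + of_int q)"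
    have "d \<noteq> 0"
      unfolding d_def using one_plus_int_nonzero[of "p + q"] by simp
    then have "of_int p * (1 + \<epsilon> * of_int p) * b * a / d - of_int q * (1 + \<epsilon> * of_int q) * a * b / d
        = (of_int p - of_int q) * a * b"
      by (simp add: field_simps) (simp add: d_def algebra_simps)
    \<comment> \<open>On the derivative side, \<open>u * deriv v - deriv u * v\<close> contributes
      \<open>(1 - q) - (1 - p) = p - q\<close>.\<close>
    then have "of_int p * (1 + \<epsilon> * of_int p) * b * a / d - of_int q * (1 + \<epsilon> * of_int q) * a * b / d
        - ((1 - of_int q) * a * b - (1 - of_int p) * a * b) = 0"
      by (simp add: algebra_simps)
    then show ?thesis
      by (simp add: F_def star_single deriv_single mult_single d_def single_diff[symmetric]
          add.commute[of q p] add.commute[of "of_int q" "of_int p"] algebra_simps)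
  qed
  have 2: "F u (Poly_Mapping.single (1 - q) b) = 0" for u q b
    by (rule additive_laurent_eq_0[where F = "\<lambda>u. F u (Poly_Mapping.single (1 - q) b)"])
      (rule 1 | simp add: F_def star_add_left star_add_right deriv_add algebra_simps)+
  have "F u v = 0"
    by (rule additive_laurent_eq_0[where F = "F u"])
      (rule 2 | simp add: F_def star_add_left star_add_right deriv_add algebra_simps)+
  then show ?thesis by (simp add: F_def)
qed

lemma quasiassociative_star: "quasiassociative (star \<epsilon>)"
proof -
  define F where "F u v w = star \<epsilon> u (star \<epsilon> v w) - star \<epsilon> (star \<epsilon> u v) w
    - (star \<epsilon> v (star \<epsilon> u w) - star \<epsilon> (star \<epsilon> v u) w)" for u v w
  have "F (Poly_Mapping.single (1 - p) a) (Poly_Mapping.single (1 - q) b)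
          (Poly_Mapping.single (1 - r) c) = 0" for p q r a b c
  proof -
    define P Q R :: 'a where PQR: "P = of_int p" "Q = of_int q" "R = of_int r"
    define d where "d t = 1 + \<epsilon> * t" for t
    \<comment> \<open>The factor common to all four triple products. In the two right-nested ones,
      the inner denominator \<open>d (Q + R)\<close> or \<open>d (P + R)\<close> cancels against the
      numerator of the outer product.\<close>
    define t where "t = R * d R * a * b * c / d (P + Q + R)"
    have nz: "d (P + Q) \<noteq> 0" "d (Q + R) \<noteq> 0" "d (P + R) \<noteq> 0"
      using one_plus_int_nonzero[of "p + q"] one_plus_int_nonzero[of "q + r"]
        one_plus_int_nonzero[of "p + r"] by (simp_all add: d_def PQR)
    have "F (Poly_Mapping.single (1 - p) a) (Poly_Mapping.single (1 - q) b)
          (Poly_Mapping.single (1 - r) c) = Poly_Mapping.single (1 - (p + q + r))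
        ((Q + R) * t - Q * d Q / d (P + Q) * t - ((P + R) * t - P * d P / d (P + Q) * t))"
      using nz by (simp add: F_def star_single single_diff[symmetric] ac_simps t_def d_def PQR)
    \<comment> \<open>The \<open>R\<close> terms drop out, leaving the commutator identity
      \<open>P * d P - Q * d Q = (P - Q) * d (P + Q)\<close>.\<close>
    moreover have "(Q + R) - Q * d Q / d (P + Q) - ((P + R) - P * d P / d (P + Q)) = 0"
      using nz(1) by (simp add: field_simps) (simp add: d_def algebra_simps)
    then have "(Q + R) * t - Q * d Q / d (P + Q) * t - ((P + R) * t - P * d P / d (P + Q) * t) = 0"
      by (simp only: left_diff_distrib[symmetric] mult_zero_left)
    ultimately show ?thesis by simp
  qed
  note F_single = this
  have "F u v w = 0" for u v w
    by (rule trilinear_laurent_eq_0[of F])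
      (rule F_single | simp add: F_def star_add_left star_add_right algebra_simps)+
  then show ?thesis
    by (simp add: quasiassociative_def bilinear_star F_def)
qed

section \<open>The cocycle condition for \<open>Omega\<close>\<close>

lemma cocycle_Omega: "generalized_2_cocycle (star \<epsilon>) (Omega \<epsilon>)"
proof -
  \<comment> \<open>Taking the residue turns the relation \<open>\<sim> 0\<close> into an additive
    equation that can be tested on monomials.\<close>
  define F where "F u v w = Res (Omega \<epsilon> v (star \<epsilon> u w) - Omega \<epsilon> u (star \<epsilon> v w)
    + Omega \<epsilon> (star \<epsilon> u v - star \<epsilon> v u) w)" for u v w
  have "F (Poly_Mapping.single (1 - p) a) (Poly_Mapping.single (1 - q) b)
          (Poly_Mapping.single (1 - r) c) = 0" for p q r a b c
  proof -
    define P Q R :: 'a where PQR: "P = of_int p" "Q = of_int q" "R = of_int r"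
    define d where "d t = 1 + \<epsilon> * t" for t
    define t where "t = R * d R * a * b * c"
    \<comment> \<open>The commutator formula removes the denominator \<open>d (P + Q)\<close> from
      the third summand.\<close>
    have comm: "star \<epsilon> (Poly_Mapping.single (1 - p) a) (Poly_Mapping.single (1 - q) b)
        - star \<epsilon> (Poly_Mapping.single (1 - q) b) (Poly_Mapping.single (1 - p) a)
        = Poly_Mapping.single (1 - (p + q)) ((P - Q) * a * b)"
      unfolding star_commutator
      by (simp add: deriv_single mult_single PQR single_diff[symmetric] algebra_simps)
    \<comment> \<open>All three residues are then governed by one condition, so their conditionals
      merge.\<close>
    have sums: "q + (p + r) = 0 \<longleftrightarrow> p + q + r = 0" "p + (q + r) = 0 \<longleftrightarrow> p + q + r = 0"
      by auto
    have F_eq: "F (Poly_Mapping.single (1 - p) a) (Poly_Mapping.single (1 - q) b)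
          (Poly_Mapping.single (1 - r) c) = (if p + q + r = 0 then
        Q\<^sup>2 * (1 - \<epsilon> * Q) * b * - (R * d R * a * c / d (P + R))
        - P\<^sup>2 * (1 - \<epsilon> * P) * a * - (R * d R * b * c / d (Q + R))
        + (P + Q)\<^sup>2 * (1 - \<epsilon> * (P + Q)) * ((P - Q) * a * b) * c else 0)"
      unfolding F_def comm
      unfolding star_single Omega_single Res_add Res_diff Res_single sums
      by (simp add: PQR d_def)
    show ?thesis
    proof (cases "p + q + r = 0")
      case True
      have dPQ: "1 - \<epsilon> * P \<noteq> 0" "1 - \<epsilon> * Q \<noteq> 0"
        using one_plus_int_nonzero[of "- p"] one_plus_int_nonzero[of "- q"] by (simp_all add: PQR)
      have "of_int (p + q + r) = (0 :: 'a)" using True by simp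
      then have sum: "P + Q + R = 0" by (simp add: PQR)
      \<comment> \<open>On the zero-sum plane \<open>d (P + R) = 1 - \<epsilon> * Q\<close> and
        \<open>d (Q + R) = 1 - \<epsilon> * P\<close>, exactly the factors contributed by
        \<open>one_plus\<close>.\<close>
      then have eqs: "P + R = - Q" "Q + R = - P" "P + Q = - R"
        by (simp_all add: algebra_simps eq_neg_iff_add_eq_0)
      have 1: "Q\<^sup>2 * (1 - \<epsilon> * Q) * b * - (R * d R * a * c / d (P + R)) = - Q\<^sup>2 * t"
        using dPQ by (simp add: eqs d_def t_def)
      have 2: "P\<^sup>2 * (1 - \<epsilon> * P) * a * - (R * d R * b * c / d (Q + R)) = - P\<^sup>2 * t"
        using dPQ by (simp add: eqs d_def t_def)
      \<comment> \<open>Here \<open>1 - \<epsilon> * (P + Q) = d R\<close>, and \<open>(P + Q)^2 *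
        (P - Q) = (P + Q) * (P^2 - Q^2) = R * (Q^2 - P^2)\<close>.\<close>
      have 3: "(P + Q)\<^sup>2 * (1 - \<epsilon> * (P + Q)) * ((P - Q) * a * b) * c = (Q\<^sup>2 - P\<^sup>2) * t"
      proof -
        have "R = - (P + Q)" using eqs(3) by simp
        then show ?thesis
          by (simp add: t_def d_def) (simp add: power2_eq_square algebra_simps)
      qed
      show ?thesis
        unfolding F_eq 1 2 3 using True by (simp add: algebra_simps)
    qed (simp add: F_eq)
  qed
  note F_single = this
  have "F u v w = 0" for u v w
    by (rule trilinear_laurent_eq_0[of F])
      (rule F_single | simp add: F_def star_add_left star_add_right Omega_add_left Omega_add_right
        Omega_diff_left Res_add Res_diff algebra_simps)+
  then show ?thesis
    by (simp add: generalized_2_cocycle_def bilinear_Omega sim_0_iff F_def)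
qed

section \<open>The form \<open>Omega_new\<close>: cocycle condition and residues\<close>

lemma Omega_new_eq:
  "Omega_new \<epsilon> u v = scale (- (1 / 2) * inverse \<epsilon>) (Omega \<epsilon> u v) - scale (1 / 2) (X (- 2) * star \<epsilon> u v)"
  by (simp add: Omega_new_def Omega_def)

lemma bilinear_Omega_new: "bilinear_map (Omega_new \<epsilon>)"
  by (rule bilinear_mapI)
    (simp_all add: Omega_new_eq Omega_add_left Omega_add_right Omega_scale_left Omega_scale_right
      star_add_left star_add_right star_scale_left star_scale_right scale_add scale_diff
      scale_scale scale_mult_right distrib_left mult.left_commute mult.commute)

lemma cocycle_Omega_new: "generalized_2_cocycle (star \<epsilon>) (Omega_new \<epsilon>)"
proof -
  have "Omega_new \<epsilon> v (star \<epsilon> u w) - Omega_new \<epsilon> u (star \<epsilon> v w)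
      + Omega_new \<epsilon> (star \<epsilon> u v - star \<epsilon> v u) w \<sim> 0" for u v w
  proof -
    \<comment> \<open>\<open>S\<close> is the cocycle expression of \<open>star\<close> itself;
      expanding the bracket by left linearity makes its vanishing a rearrangement of
      quasiassociativity.\<close>
    define S where "S = star \<epsilon> v (star \<epsilon> u w) - star \<epsilon> u (star \<epsilon> v w)
      + star \<epsilon> (star \<epsilon> u v - star \<epsilon> v u) w"
    define T where "T = Omega \<epsilon> v (star \<epsilon> u w) - Omega \<epsilon> u (star \<epsilon> v w)
      + Omega \<epsilon> (star \<epsilon> u v - star \<epsilon> v u) w"
    have "S = 0"
      using quasiassociative_star
      by (simp add: S_def quasiassociative_def star_diff_left algebra_simps)
    moreover have "Res T = 0"
      using cocycle_Omega by (simp add: T_def generalized_2_cocycle_def sim_0_iff)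
    \<comment> \<open>The cocycle expression depends linearly on the form, and the fixed factor
      \<open>X (- 2)\<close> can be pulled out.\<close>
    moreover have "Omega_new \<epsilon> v (star \<epsilon> u w) - Omega_new \<epsilon> u (star \<epsilon> v w)
      + Omega_new \<epsilon> (star \<epsilon> u v - star \<epsilon> v u) w
      = scale (- (1 / 2) * inverse \<epsilon>) T - scale (1 / 2) (X (- 2) * S)"
      by (simp add: Omega_new_eq T_def S_def scale_add scale_diff distrib_left right_diff_distrib)
    ultimately show ?thesis
      by (simp add: sim_0_iff Res_diff Res_scale) (simp add: Res_def)
  qed
  then show ?thesis
    by (simp add: generalized_2_cocycle_def bilinear_Omega_new)
qed

lemma X_eq_single: "X (1 - p) = Poly_Mapping.single (1 - p) 1"
  by (simp add: X_def)

lemma star_X: "star \<epsilon> (X (1 - p)) (X (1 - q)) =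
    scale (- (of_int q * (1 + \<epsilon> * of_int q) / (1 + \<epsilon> * of_int (p + q)))) (X (1 - p - q))"
proof -
  have "1 - p - q = 1 - (p + q)" by simp
  then show ?thesis
    by (simp only: X_eq_single star_single scale_single mult_1_right)
qed

lemma Res_Omega_new_X: "Res (Omega_new \<epsilon> (X (1 - p)) (X (1 - q))) =
    1 / 2 * (of_int p ^ 3 - of_int p + (\<epsilon> - inverse \<epsilon>) * of_int p ^ 2) * (if p + q = 0 then 1 else 0)"
proof -
  \<comment> \<open>Both terms live in exponent \<open>-1 - (p + q)\<close>, so only
    \<open>p + q = 0\<close> contributes. There the denominator
    \<open>1 + \<epsilon> * of_int (p + q)\<close> is 1; keeping \<open>of_int (p + q)\<close>
    unsplit lets the simplifier see this.\<close>
  have "Res (Omega_new \<epsilon> (X (1 - p)) (X (1 - q))) =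
      - (1 / 2) * inverse \<epsilon> * (if p + q = 0 then of_int p ^ 2 * (1 - \<epsilon> * of_int p) else 0)
      + 1 / 2 * (if p + q = 0 then of_int q * (1 + \<epsilon> * of_int q) else 0)"
    unfolding Omega_new_eq X_eq_single star_single Omega_single Res_diff Res_scale
    by (auto simp: Res_def lookup_X_mult lookup_single when_def simp del: of_int_add)
  also have "\<dots> = 1 / 2 * (of_int p ^ 3 - of_int p + (\<epsilon> - inverse \<epsilon>) * of_int p ^ 2)
      * (if p + q = 0 then 1 else 0)"
  proof (cases "p + q = 0")
    case True
    then have "q = - p" by simp
    then show ?thesis
      using nonzero by (simp add: field_simps power2_eq_square power3_eq_cube)
  qed simp
  finally show ?thesis .
qed

end

theorem mainTheorem2:
  fixes \<epsilon> :: "'a::field_char_0"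
  assumes "\<epsilon> \<noteq> 0" and "inverse \<epsilon> \<notin> \<int>"
  shows
    "(quasiassociative (star \<epsilon>)
      \<and> (\<forall>u v. star \<epsilon> u v - star \<epsilon> v u = u * deriv v - deriv u * v)
      \<and> (\<forall>p q :: int. star \<epsilon> (X (1 - p)) (X (1 - q)) =
           scale (- (of_int q * (1 + \<epsilon> * of_int q) / (1 + \<epsilon> * of_int (p + q)))) (X (1 - p - q))))
    \<and> generalized_2_cocycle (star \<epsilon>) (Omega \<epsilon>)
    \<and> (generalized_2_cocycle (star \<epsilon>) (Omega_new \<epsilon>)
      \<and> (\<forall>p q :: int. Res (Omega_new \<epsilon> (X (1 - p)) (X (1 - q))) =
           1 / 2 * (of_int p ^ 3 - of_int p + (\<epsilon> - inverse \<epsilon>) * of_int p ^ 2) *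
           (if p + q = 0 then 1 else 0)))"
  using assms
  by (simp only: quasiassociative_star star_commutator star_X cocycle_Omega cocycle_Omega_new
      Res_Omega_new_X simp_thms)

end
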